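(* Let $n$ be a non-negative integer and let $p,q$ be real numbers with $0<p,q<1$ and $p+q=1$. Then $$p\,{}_2F_1\left(\begin{array}{c}-n,\ 1\\-2n\end{array};\ \frac{1}{q}\right)+q\,{}_2F_1\left(\begin{array}{c}-n,\ 1\\-2n\end{array};\ \frac{1}{p}\right)=\frac{(n!)^2}{p^nq^n\,(2n)!}=\frac{(1)_n}{2^{2n}\,p^nq^n\,(\frac{1}{2})_n}.$$
   Context: $(a)_r$ denotes the Pochhammer symbol, $(a)_r=\Gamma(a+r)/\Gamma(a)$, i.e. $(a)_0=1$ and $(a)_r=a(a+1)\cdots(a+r-1)$ for integers $r\ge 1$ (the product form being used when $a$ is a non-positive integer). The symbol ${}_2F_1\left(\begin{array}{c}a,\ b\\c\end{array};x\right)$ denotes the Gauss hypergeometric function $\sum_{r\ge 0}\frac{(a)_r(b)_r}{(c)_r\,r!}x^r$. With $a=-n$, $b=1$, $c=-2n$, the series is understood to terminate after $n+1$ terms, so that $${}_2F_1\left(\begin{array}{c}-n,\ 1\\-2n\end{array};x\right)=\sum_{r=0}^{n}\frac{(-n)_r(1)_r}{(-2n)_r\,r!}\,x^r ,$$ where the denominators $(-2n)_r$ are nonzero for $0\le r\le n$ (for $n=0$ the sum equals $1$). *)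

theory Defs
  imports "HOL-Analysis.Analysis"
begin

text \<open>
  The Gauss hypergeometric function of real arguments, as the sum of its power series.

  When \<open>c\<close> is a non-positive integer, \<open>pochhammer c r\<close> vanishes for all
  \<open>r > -c\<close>, and by the convention \<open>x / 0 = 0\<close> the corresponding terms are zero.
  For \<open>a = -n\<close>, \<open>b = 1\<close>, \<open>c = -2n\<close> this is exactly the usual
  convention that the series terminates after \<open>n + 1\<close> terms, see
  \<open>gauss_2F1_terminating\<close> below.
\<close>

definition gauss_2F1 :: "real \<Rightarrow> real \<Rightarrow> real \<Rightarrow> real \<Rightarrow> real" where
  "gauss_2F1 a b c x =
     (\<Sum>r. pochhammer a r * pochhammer b r / (pochhammer c r * fact r) * x ^ r)"

lemma gauss_2F1_terminating:
  "gauss_2F1 (- real n) 1 (- 2 * real n) x =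
     (\<Sum>r=0..n. pochhammer (- real n) r * pochhammer 1 r /
        (pochhammer (- 2 * real n) r * fact r) * x ^ r)"
  unfolding gauss_2F1_def
  by (rule suminf_finite) (auto simp: pochhammer_of_nat_eq_0_lemma)

lemma gauss_2F1_denominator_nonzero:
  assumes "r \<le> n"
  shows "pochhammer (- 2 * real n) r \<noteq> 0"
  using pochhammer_of_nat_eq_0_lemma'[of r "2 * n", where ?'a = real] assms by simp

lemma gauss_2F1_eq_eval_fps_hypergeo:
  "gauss_2F1 a b c x = eval_fps (fps_hypergeo [a, b] [c] 1) x"
  by (simp add: gauss_2F1_def eval_fps_def fps_hypergeo_def)

end

theory Submission
  imports Defs
begin

text \<open>
  Since \<open>(-n)\<^sub>r / (-2n)\<^sub>r = (2n-r choose n) / (2n choose n)\<close>, multiplying the left-hand side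
  by \<open>(2n choose n) p\<^sup>n q\<^sup>n\<close> and reversing both sums with \<open>k = n - r\<close> turns the first
  equation into
  \<open>(\<Sum>k\<le>n. (n+k choose k) p\<^bsup>n+1\<^esup> q\<^sup>k) + (\<Sum>k\<le>n. (n+k choose k) q\<^bsup>n+1\<^esup> p\<^sup>k) = 1\<close>.
  This is the diagonal case of the Chaundy--Bullard identity, which says that somebody wins in
  Pascal's problem of points: in independent trials with success probability \<open>p\<close>, the first sum is
  the probability that \<open>n + 1\<close> successes occur before \<open>n + 1\<close> failures, and the second sum is the
  probability of the opposite outcome. Conditioning on the first trial relates targets \<open>(a, b)\<close> to
  \<open>(a - 1, b)\<close> and \<open>(a, b - 1)\<close>, so the identity is proved for two independent targets
  (lemmas \<open>race_win_step\<close> and \<open>chaundy_bullard\<close>); lemma \<open>gauss_2F1_eq_race_win\<close> makes the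
  translation. The second equation is the duplication formula for \<open>(2n)!\<close>.
\<close>

text \<open>
  For real \<open>p \<in> [0, 1]\<close> and \<open>q = 1 - p\<close>, the probability that \<open>a\<close> successes come
  before \<open>b\<close> failures, summed over the number \<open>k\<close> of failures seen when the race ends. Truncated subtraction gives
  the right value also at \<open>a = 0\<close>: there only the term \<open>k = 0\<close> survives.
\<close>

definition race_win :: "'a :: comm_ring_1 \<Rightarrow> 'a \<Rightarrow> nat \<Rightarrow> nat \<Rightarrow> 'a" where
  "race_win p q a b = (\<Sum>k<b. of_nat ((a + k - 1) choose k) * p ^ a * q ^ k)"

lemma race_win_0_right [simp]: "race_win p q a 0 = 0"
  by (simp add: race_win_def)

lemma race_win_0_left [simp]: "race_win p q 0 (Suc b) = 1"
  unfolding race_win_def by (subst sum.lessThan_Suc_shift) (simp add: binomial_eq_0)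

text \<open>
  Conditioning on the first trial; on the coefficients of the sums this is Pascal's rule.
\<close>

lemma race_win_step:
  "race_win p q (Suc a) (Suc b) = p * race_win p q a (Suc b) + q * race_win p q (Suc a) b"
  unfolding race_win_def sum.lessThan_Suc_shift
  by (simp add: sum_distrib_left sum.distrib [symmetric] algebra_simps)

theorem chaundy_bullard:
  fixes p q :: "'a :: comm_ring_1"
  assumes "p + q = 1" "a > 0 \<or> b > 0"
  shows "race_win p q a b + race_win q p b a = 1"
  using assms(2)
proof (induction "a + b" arbitrary: a b rule: less_induct)
  case less
  show ?case
  proof (cases "a = 0 \<or> b = 0")
    case True
    then show ?thesis
      using less.prems by (auto simp: gr0_conv_Suc)
  next
    case False
    then obtain c d where cd: "a = Suc c" "b = Suc d"
      by (auto simp: gr0_conv_Suc)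
    have "race_win p q a b + race_win q p b a
        = p * (race_win p q c b + race_win q p b c) + q * (race_win p q a d + race_win q p d a)"
      by (simp add: cd race_win_step algebra_simps)
    also have "race_win p q c b + race_win q p b c = 1"
      by (rule less.hyps) (simp_all add: cd)
    also have "race_win p q a d + race_win q p d a = 1"
      by (rule less.hyps) (simp_all add: cd)
    finally show ?thesis
      using assms(1) by simp
  qed
qed

lemma pochhammer_minus_of_nat:
  "pochhammer (- of_nat n) r = (- 1) ^ r * fact r * (of_nat (n choose r) :: 'a :: field_char_0)"
  by (simp add: binomial_gbinomial gbinomial_pochhammer)

lemma pochhammer_ratio:
  assumes "r \<le> n"
  shows "pochhammer (- real n) r / pochhammer (- 2 * real n) r
       = real ((2 * n - r) choose n) / real ((2 * n) choose n)"
proof -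
  have "pochhammer (- real n) r / pochhammer (- 2 * real n) r
      = real (n choose r) / real ((2 * n) choose r)"
    using pochhammer_minus_of_nat [of n r, where 'a = real]
      pochhammer_minus_of_nat [of "2 * n" r, where 'a = real] by simp
  also have "\<dots> = real ((2 * n - r) choose n) / real ((2 * n) choose n)"
    using assms by (simp add: binomial_fact field_simps mult_2)
  finally show ?thesis .
qed

text \<open>
  Term by term, with the order reversed: up to the common factor, the summand of index \<open>r\<close> of the
  hypergeometric sum is the one of index \<open>n - r\<close> of the race, which is the probability of winning
  after exactly \<open>n - r\<close> failures when \<open>p + q = 1\<close>.
\<close>

lemma gauss_2F1_eq_race_win:
  fixes p q :: real
  assumes "q \<noteq> 0"
  shows "real ((2 * n) choose n) * p ^ n * q ^ n * (p * gauss_2F1 (- real n) 1 (- 2 * real n) (1 / q))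
       = race_win p q (Suc n) (Suc n)"
proof -
  have "gauss_2F1 (- real n) 1 (- 2 * real n) (1 / q)
      = (\<Sum>r\<le>n. real ((2 * n - r) choose n) / real ((2 * n) choose n) * (1 / q) ^ r)"
    unfolding gauss_2F1_terminating atMost_atLeast0
    by (intro sum.cong refl)
      (simp add: pochhammer_ratio [symmetric] pochhammer_fact [symmetric])
  then have "real ((2 * n) choose n) * p ^ n * q ^ n
        * (p * gauss_2F1 (- real n) 1 (- 2 * real n) (1 / q))
      = (\<Sum>r\<le>n. real ((2 * n - r) choose n) * p ^ Suc n * q ^ (n - r))"
    using assms by (simp add: sum_distrib_left power_diff power_one_over field_simps)
  also have "\<dots> = (\<Sum>k\<le>n. real ((n + k) choose n) * p ^ Suc n * q ^ k)"
    by (rule sum.reindex_bij_witness [of _ "\<lambda>k. n - k" "\<lambda>r. n - r"]) (auto simp: mult_2)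
  also have "\<dots> = race_win p q (Suc n) (Suc n)"
    unfolding race_win_def lessThan_Suc_atMost
    by (intro sum.cong refl) (simp add: binomial_symmetric [of n "n + _"])
  finally show ?thesis .
qed

theorem theorem1:
  fixes n :: nat and p q :: real
  assumes "0 < p" "p < 1" "0 < q" "q < 1" "p + q = 1"
  shows "p * gauss_2F1 (- real n) 1 (- 2 * real n) (1 / q)
           + q * gauss_2F1 (- real n) 1 (- 2 * real n) (1 / p)
         = (fact n)\<^sup>2 / (p ^ n * q ^ n * fact (2 * n)) \<and>
         (fact n)\<^sup>2 / (p ^ n * q ^ n * fact (2 * n))
         = pochhammer 1 n / (2 ^ (2 * n) * p ^ n * q ^ n * pochhammer (1 / 2) n)"
proof
  let ?F = "\<lambda>x. gauss_2F1 (- real n) 1 (- 2 * real n) (1 / x)"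
  let ?C = "real ((2 * n) choose n)"
  have "?C * p ^ n * q ^ n * (p * ?F q + q * ?F p)
      = ?C * p ^ n * q ^ n * (p * ?F q) + ?C * q ^ n * p ^ n * (q * ?F p)"
    by (simp add: algebra_simps)
  also have "\<dots> = race_win p q (Suc n) (Suc n) + race_win q p (Suc n) (Suc n)"
    using assms by (simp only: gauss_2F1_eq_race_win)
  also have "\<dots> = 1"
    using assms by (intro chaundy_bullard) simp_all
  finally have "p * ?F q + q * ?F p = 1 / (?C * p ^ n * q ^ n)"
    using assms by (simp add: field_simps)
  also have "?C = fact (2 * n) / (fact n)\<^sup>2"
    by (simp add: binomial_fact power2_eq_square mult_2)
  finally show "p * ?F q + q * ?F p = (fact n)\<^sup>2 / (p ^ n * q ^ n * fact (2 * n))"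
    by (simp add: mult_ac)
  show "(fact n)\<^sup>2 / (p ^ n * q ^ n * fact (2 * n))
      = pochhammer 1 n / (2 ^ (2 * n) * p ^ n * q ^ n * pochhammer (1 / 2) n)"
    unfolding fact_double pochhammer_fact [symmetric] by (simp add: power2_eq_square)
qed

end
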